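(* Let $p$ be a prime and suppose $E\subset\mathbb{F}_p^2$ $1$-tiles $\mathbb{F}_p^2$ by $A\subset \mathbb{F}_p^2$. Then $E$ is a graph. More precisely, either $|E|=1$ and $A=\mathbb{F}_p^2$, or $E=\mathbb{F}_p^2$ and $|A|=1$, or there is a basis $\{e_1,e_2\}$ of $\mathbb{F}_p^2$ and a function $f:\mathbb{F}_p\to\mathbb{F}_p$ such that $E=\{x e_1 + f(x) e_2 : x\in\mathbb{F}_p\}$. Moreover, the function $f$ can always be given by a polynomial of degree at most $p-1$.
   Context: $E$ $k$-tiles $\mathbb{F}_p^d$ by $A$ means $\sum_{a\in A}1_E(x-a)=k$ for every $x\in\mathbb{F}_p^d$. A set $E\subset\mathbb{F}_p^d$ is a graph if there exist an integer $0\le s\le d$, a basis $e_1,\dots,e_d$ of $\mathbb{F}_p^d$ and a function $f=(f_1,\dots,f_{d-s}):\mathbb{F}_p^s\to\mathbb{F}_p^{d-s}$ such that $E=\{\sum_{i=1}^s x_i e_i+\sum_{j=1}^{d-s} f_j(x)e_{s+j} : x=(x_1,\dots,x_s)\in\mathbb{F}_p^s\}$ (i.e., $E$ is the graph of $f$ with respect to this coordinate decomposition). *)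

theory Defs
  imports
    "HOL-Analysis.Analysis"
    "HOL-Computational_Algebra.Polynomial"
    "Berlekamp_Zassenhaus.Finite_Field"
begin

(* The prime field F_p is 'p mod_ring with 'p :: prime_card and p = CARD('p),
   and F_p^d is 'p mod_ring ^ 'd with d = CARD('d). *)

definition k_tiles ::
  "nat \<Rightarrow> ('p::prime_card mod_ring ^ 'd::finite) set \<Rightarrow> ('p mod_ring ^ 'd) set \<Rightarrow> bool" where
  "k_tiles k E A \<longleftrightarrow> (\<forall>x. (\<Sum>a\<in>A. indicator E (x - a) :: nat) = k)"

definition is_basis :: "('p::prime_card mod_ring ^ 'd::finite) set \<Rightarrow> bool" where
  "is_basis B \<longleftrightarrow> vec.independent B \<and> vec.span B = UNIV"

(* F_p^n for a term-level n: the functions on {1..n}, extensional outside it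
   (a single point when n = 0). *)
definition coord_space :: "nat \<Rightarrow> (nat \<Rightarrow> 'p::prime_card mod_ring) set" where
  "coord_space n = {1..n} \<rightarrow>\<^sub>E UNIV"

definition is_graph :: "('p::prime_card mod_ring ^ 'd::finite) set \<Rightarrow> bool" where
  "is_graph E \<longleftrightarrow>
    (\<exists>s \<le> CARD('d). \<exists>e :: nat \<Rightarrow> 'p mod_ring ^ 'd.
      inj_on e {1..CARD('d)} \<and> is_basis (e ` {1..CARD('d)}) \<and>
      (\<exists>f \<in> coord_space s \<rightarrow> coord_space (CARD('d) - s).
        E = {(\<Sum>i=1..s. x i *s e i) + (\<Sum>j=1..CARD('d) - s. f x j *s e (s + j)) | x.
              x \<in> coord_space s}))"

end

theory Submission
  imports Defs
begin

text \<open>The cardinalities of \<open>E\<close> and \<open>A\<close> multiply to \<open>p\<^sup>2\<close>, so the interesting case is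
  \<open>|E| = |A| = p\<close>. Project onto the quotient by a line through the origin. The numbers of points of
  \<open>E\<close> and of \<open>A\<close> on the parallel lines have a constant cyclic convolution, so their generating
  polynomials multiply to a multiple of \<open>1 + X + \<dots> + X\<^bsup>p-1\<^esup>\<close>, which is prime in the integer polynomials.
  Hence \<open>E\<close> or \<open>A\<close> meets every parallel line exactly once. Taking the line in the direction of the
  difference of two points of \<open>A\<close> rules out \<open>A\<close>, so \<open>E\<close> is a graph over that quotient.\<close>

subsection \<open>The cyclotomic polynomial of prime index\<close>

definition geom_poly :: "nat \<Rightarrow> 'a::comm_ring_1 poly" where
  "geom_poly n = (\<Sum>i<n. Polynomial.monom 1 i)"

lemma monom_minus_one_eq_geom_poly:
  "Polynomial.monom 1 n - 1 = [:-1, 1:] * (geom_poly n :: 'a::comm_ring_1 poly)"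
proof -
  have "[:-1, 1:] = [:0, 1:] - (1 :: 'a poly)"
    by (simp add: one_pCons)
  then show ?thesis
    by (simp add: geom_poly_def monom_altdef power_diff_1_eq)
qed

lemma coeff_geom_poly:
  "Polynomial.coeff (geom_poly n :: 'a::comm_ring_1 poly) i = (if i < n then 1 else 0)"
  by (simp add: geom_poly_def Polynomial.coeff_sum)

lemma degree_geom_poly: "n > 0 \<Longrightarrow> degree (geom_poly n :: 'a::comm_ring_1 poly) = n - 1"
  by (intro antisym degree_le le_degree) (auto simp: coeff_geom_poly)

lemma poly_geom_poly_1: "poly (geom_poly n :: 'a::comm_ring_1 poly) 1 = of_nat n"
  by (simp add: geom_poly_def poly_sum poly_monom)

lemma of_int_geom_poly: "map_poly of_int (geom_poly n) = (geom_poly n :: 'a::comm_ring_1 poly)"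
  by (rule poly_eqI) (simp add: coeff_map_poly coeff_geom_poly)

text \<open>In characteristic \<open>p\<close> the Frobenius identity turns
  \<open>((X - 1) + 1)^p\<close> into \<open>(X - 1)^p + 1\<close>. Hence
  \<open>X^p - 1 = (X - 1)^p\<close>, and one factor \<open>X - 1\<close> cancels.\<close>

lemma geom_poly_mod_prime:
  "geom_poly CARD('p) = ([:-1, 1:] ^ (CARD('p) - 1) :: 'p::prime_card mod_ring poly)"
proof -
  let ?L = "[:-1, 1:] :: 'p mod_ring poly"
  have p: "prime CARD('p)" by (rule prime_card)
  have "Polynomial.monom 1 CARD('p) = (?L + 1) ^ CARD('p)"
    by (simp add: monom_altdef one_pCons)
  also have "\<dots> = ?L ^ CARD('p) + 1"
    using p by (subst freshmans_dream) auto
  finally have "?L * geom_poly CARD('p) = ?L ^ CARD('p)"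
    by (metis add_diff_cancel_right' monom_minus_one_eq_geom_poly)
  also have "\<dots> = ?L * ?L ^ (CARD('p) - 1)"
    using prime_gt_0_nat[OF p] by (simp flip: power_Suc)
  finally show ?thesis
    by (subst (asm) mult_cancel_left) simp
qed

text \<open>If \<open>c\<close> were not a root, the prime \<open>X - c\<close> and hence its powers
  would be coprime to \<open>g\<close>, so that \<open>g\<close>, dividing such a power, would be a
  unit.\<close>

lemma dvd_linear_power_imp_root:
  fixes g :: "'a::field_gcd poly"
  assumes "g dvd [:-c, 1:] ^ n" "degree g > 0"
  shows "poly g c = 0"
proof (rule ccontr)
  assume "poly g c \<noteq> 0"
  then have "\<not> [:-c, 1:] dvd g"
    by (simp add: poly_eq_0_iff_dvd)
  then have "coprime [:-c, 1:] g"
    by (intro prime_elem_imp_coprime prime_elem_linear_field_poly) auto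
  then have "coprime ([:-c, 1:] ^ n) g"
    by simp
  with assms(1) have "is_unit g"
    by (metis coprime_absorb_right)
  with assms(2) show False
    by (auto simp: is_unit_poly_iff)
qed

text \<open>Eisenstein's argument without shifting the variable: a factor of positive degree reduces
  to a power of \<open>X - 1\<close> modulo \<open>p\<close>, so two such factors would force \<open>p\<^sup>2\<close> to divide
  the value \<open>p\<close> at \<open>1\<close>.\<close>

lemma prime_elem_geom_poly: "prime_elem (geom_poly CARD('p::prime_card) :: int poly)"
proof (rule irreducible_imp_prime_elem, rule irreducibleI)
  let ?G = "geom_poly CARD('p) :: int poly"
  have p: "prime CARD('p)" by (rule prime_card)
  have deg: "degree ?G = CARD('p) - 1" "CARD('p) > 1"
    using prime_gt_1_nat[OF p] by (auto simp: degree_geom_poly)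
  then show "?G \<noteq> 0" by auto
  show "\<not> ?G dvd 1"
    using deg by (auto simp: is_unit_poly_iff)
  fix g h assume gh: "?G = g * h"
  have "lead_coeff ?G = 1"
    using deg by (simp add: coeff_geom_poly)
  then have lc: "lead_coeff g * lead_coeff h = 1"
    by (simp add: gh lead_coeff_mult)
  \<comment> \<open>Integer constants need not be units. Both leading coefficients are units here
    because their product is 1, so a non-unit factor must have positive degree.\<close>
  have unit: "is_unit q" if "degree q = 0" "is_unit (lead_coeff q)" for q :: "int poly"
    using that by (metis degree_eq_zeroE is_unit_const_poly_iff coeff_pCons_0)
  have root: "int CARD('p) dvd poly q 1"
    if q: "q dvd ?G" "is_unit (lead_coeff q)" "degree q > 0" for q
  proof -
    let ?q = "map_poly of_int q :: 'p mod_ring poly"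
    obtain r where "?G = q * r" using q(1) by auto
    then have "?q * map_poly of_int r = (geom_poly CARD('p) :: 'p mod_ring poly)"
      by (metis of_int_geom_poly of_int_poly_hom.hom_mult)
    then have "?q dvd [:-1, 1:] ^ (CARD('p) - 1)"
      by (metis dvd_triv_left geom_poly_mod_prime)
    \<comment> \<open>A unit of the integers is 1 or -1 and does not vanish modulo \<open>p\<close>,
      so reduction preserves the degree.\<close>
    moreover have "(of_int (lead_coeff q) :: 'p mod_ring) \<noteq> 0"
      using q(2) by (auto simp: abs_if split: if_splits)
    then have "degree ?q = degree q"
      by (rule map_poly_degree_eq)
    ultimately have "poly ?q 1 = 0"
      using q(3) by (intro dvd_linear_power_imp_root) auto
    then show ?thesis
      by (simp add: of_int_eq_0_iff_char_dvd)
  qed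
  show "g dvd 1 \<or> h dvd 1"
  proof (rule ccontr)
    assume neg: "\<not> (g dvd 1 \<or> h dvd 1)"
    have "is_unit (lead_coeff g)" "is_unit (lead_coeff h)"
      using lc by (metis dvd_triv_left, metis dvd_triv_right)
    moreover from this have "degree g > 0" "degree h > 0"
      using neg unit by blast+
    ultimately have "int CARD('p) dvd poly g 1" "int CARD('p) dvd poly h 1"
      by (auto intro!: root simp: gh)
    then have "int CARD('p) * int CARD('p) dvd poly ?G 1"
      by (simp add: gh mult_dvd_mono)
    then show False
      using deg(2) by (simp add: poly_geom_poly_1)
  qed
qed

subsection \<open>Convolutions on the prime field\<close>

definition mod_ring_nat :: "'p::prime_card mod_ring \<Rightarrow> nat" where
  "mod_ring_nat x = nat (to_int_mod_ring x)"

lemma of_nat_mod_ring_nat: "of_nat (mod_ring_nat x) = (x :: 'p::prime_card mod_ring)"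
proof -
  have "to_int_mod_ring x \<ge> 0"
    using range_to_int_mod_ring[where 'a='p] by auto
  then show ?thesis
    by (simp add: mod_ring_nat_def of_nat_of_int_mod_ring)
qed

lemma mod_ring_nat_less: "mod_ring_nat (x :: 'p::prime_card mod_ring) < CARD('p)"
proof -
  have "to_int_mod_ring x \<in> {0..<int CARD('p)}"
    by (metis rangeI range_to_int_mod_ring)
  then show ?thesis
    by (simp add: mod_ring_nat_def nat_less_iff)
qed

lemma inj_mod_ring_nat: "inj (mod_ring_nat :: 'p::prime_card mod_ring \<Rightarrow> nat)"
  by (metis injI of_nat_mod_ring_nat)

lemma bij_betw_mod_ring_nat:
  "bij_betw (mod_ring_nat :: 'p::prime_card mod_ring \<Rightarrow> nat) UNIV {..<CARD('p)}"
  unfolding bij_betw_def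
proof
  show "range (mod_ring_nat :: 'p mod_ring \<Rightarrow> nat) = {..<CARD('p)}"
    by (rule card_subset_eq) (auto simp: mod_ring_nat_less card_image inj_mod_ring_nat)
qed (rule inj_mod_ring_nat)

lemma mod_ring_nat_add:
  fixes x y :: "'p::prime_card mod_ring"
  shows "(mod_ring_nat x + mod_ring_nat y) mod CARD('p) = mod_ring_nat (x + y)"
proof -
  have "(of_nat (mod_ring_nat x + mod_ring_nat y) :: 'p mod_ring) = of_nat (mod_ring_nat (x + y))"
    by (simp add: of_nat_mod_ring_nat)
  then have "[mod_ring_nat x + mod_ring_nat y = mod_ring_nat (x + y)] (mod CARD('p))"
    unfolding of_nat_eq_iff_cong_CHAR by simp
  then show ?thesis
    by (simp add: cong_def mod_ring_nat_less)
qed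

text \<open>The generating polynomial of a function on the prime field. All exponents lie below
  \<open>CARD('p)\<close>, so it is the reduced representative of an element of the group ring
  \<open>Z[X]/(X^p - 1)\<close>.\<close>

definition mod_ring_poly :: "('p::prime_card mod_ring \<Rightarrow> int) \<Rightarrow> int poly" where
  "mod_ring_poly \<alpha> = (\<Sum>y\<in>UNIV. Polynomial.monom (\<alpha> y) (mod_ring_nat y))"

lemma coeff_mod_ring_poly: "Polynomial.coeff (mod_ring_poly \<alpha>) (mod_ring_nat x) = \<alpha> x"
  by (simp add: mod_ring_poly_def Polynomial.coeff_sum inj_eq[OF inj_mod_ring_nat])

lemma degree_mod_ring_poly:
  "degree (mod_ring_poly (\<alpha> :: 'p::prime_card mod_ring \<Rightarrow> int)) \<le> CARD('p) - 1"
  unfolding mod_ring_poly_def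
proof (intro degree_sum_le)
  fix y :: "'p mod_ring"
  show "degree (Polynomial.monom (\<alpha> y) (mod_ring_nat y)) \<le> CARD('p) - 1"
    using mod_ring_nat_less[of y] by (intro order.trans[OF degree_monom_le]) simp
qed simp

lemma mod_ring_poly_const:
  "mod_ring_poly (\<lambda>_ :: 'p::prime_card mod_ring. c) = Polynomial.smult c (geom_poly CARD('p))"
proof -
  have "mod_ring_poly (\<lambda>_ :: 'p mod_ring. c) = (\<Sum>i<CARD('p). Polynomial.monom c i)"
    unfolding mod_ring_poly_def by (rule sum.reindex_bij_betw[OF bij_betw_mod_ring_nat])
  also have "\<dots> = Polynomial.smult c (geom_poly CARD('p))"
    by (rule poly_eqI) (simp add: coeff_geom_poly Polynomial.coeff_sum)
  finally show ?thesis .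
qed

text \<open>Modulo \<open>X^n - 1\<close> an exponent matters only through its residue modulo
  \<open>n\<close>, and \<open>geom_poly n\<close> divides \<open>X^n - 1\<close>.\<close>

lemma geom_poly_dvd_monom_mod:
  "geom_poly n dvd Polynomial.monom c i - Polynomial.monom (c :: 'a::comm_ring_1) (i mod n)"
proof -
  have "Polynomial.monom 1 n - 1 dvd Polynomial.monom (1::'a) n ^ (i div n) - 1"
    by (simp only: power_diff_1_eq dvd_triv_left)
  then have "geom_poly n dvd Polynomial.monom (1::'a) n ^ (i div n) - 1"
    by (metis dvd_trans dvd_triv_right monom_minus_one_eq_geom_poly)
  then have "geom_poly n dvd Polynomial.monom c (i mod n) * (Polynomial.monom (1::'a) n ^ (i div n) - 1)"
    by (rule dvd_mult)
  also have "\<dots> = Polynomial.monom c i - Polynomial.monom c (i mod n)"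
    by (simp add: right_diff_distrib mult_monom monom_power)
  finally show ?thesis .
qed

text \<open>Cyclic convolution is multiplication of generating polynomials followed by reduction of
  the exponents modulo \<open>p\<close>, and that reduction changes the product by a multiple of
  \<open>geom_poly CARD('p)\<close>.\<close>

lemma geom_poly_dvd_mod_ring_poly_mult:
  fixes \<alpha> \<beta> :: "'p::prime_card mod_ring \<Rightarrow> int"
  shows "geom_poly CARD('p) dvd
    mod_ring_poly \<alpha> * mod_ring_poly \<beta> - mod_ring_poly (\<lambda>x. \<Sum>y\<in>UNIV. \<alpha> y * \<beta> (x - y))"
proof -
  let ?m = "\<lambda>y z. Polynomial.monom (\<alpha> y * \<beta> z)"
  let ?n = "mod_ring_nat :: 'p mod_ring \<Rightarrow> nat"
  have monom_sum: "Polynomial.monom (sum f S) k = (\<Sum>i\<in>S. Polynomial.monom (f i) k)"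
    for f :: "'p mod_ring \<Rightarrow> int" and S k
    by (rule poly_eqI) (simp add: Polynomial.coeff_sum)
  have "mod_ring_poly (\<lambda>x. \<Sum>y\<in>UNIV. \<alpha> y * \<beta> (x - y)) = (\<Sum>y\<in>UNIV. \<Sum>x\<in>UNIV. ?m y (x - y) (?n x))"
    unfolding mod_ring_poly_def monom_sum by (rule sum.swap)
  also have "\<dots> = (\<Sum>y\<in>UNIV. \<Sum>z\<in>UNIV. ?m y z (?n (y + z)))"
  proof (rule sum.cong[OF refl])
    fix y
    show "(\<Sum>x\<in>UNIV. ?m y (x - y) (?n x)) = (\<Sum>z\<in>UNIV. ?m y z (?n (y + z)))"
      by (rule sum.reindex_bij_witness[of _ "\<lambda>z. y + z" "\<lambda>x. x - y"]) auto
  qed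
  also have "mod_ring_poly \<alpha> * mod_ring_poly \<beta> - \<dots> =
      (\<Sum>y\<in>UNIV. \<Sum>z\<in>UNIV. ?m y z (?n y + ?n z) - ?m y z ((?n y + ?n z) mod CARD('p)))"
    by (simp add: mod_ring_poly_def sum_product mult_monom sum_subtractf mod_ring_nat_add)
  finally show ?thesis
    by (simp only:) (intro dvd_sum geom_poly_dvd_monom_mod)
qed

text \<open>The generating polynomial has degree at most \<open>p - 1\<close>, the degree of the
  divisor. The cofactor is therefore a constant, which is the common value of all
  coefficients.\<close>

lemma constant_if_geom_poly_dvd:
  fixes \<alpha> :: "'p::prime_card mod_ring \<Rightarrow> int"
  assumes "geom_poly CARD('p) dvd mod_ring_poly \<alpha>"
  shows "\<exists>c. \<forall>x. \<alpha> x = c"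
proof -
  let ?G = "geom_poly CARD('p) :: int poly"
  obtain r where r: "mod_ring_poly \<alpha> = ?G * r" using assms by auto
  have p: "CARD('p) > 1" using prime_gt_1_nat[OF prime_card] .
  have "degree r = 0"
  proof (cases "r = 0")
    case False
    moreover have "?G \<noteq> 0" using degree_geom_poly[of "CARD('p)", where 'a=int] p by auto
    ultimately have "degree (?G * r) = CARD('p) - 1 + degree r"
      using p by (simp add: degree_mult_eq degree_geom_poly)
    then show ?thesis
      using degree_mod_ring_poly[of \<alpha>] p by (simp add: r)
  qed simp
  then obtain c where c: "r = [:c:]"
    by (rule degree_eq_zeroE)
  have "\<alpha> x = c" for x
    using coeff_mod_ring_poly[of \<alpha> x] by (simp add: r c coeff_geom_poly mod_ring_nat_less)
  then show ?thesis by auto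
qed

text \<open>The generating polynomial of a constant is a multiple of
  \<open>geom_poly CARD('p)\<close>, so this prime divides the product of the two generating
  polynomials, hence one of them.\<close>

lemma constant_if_convolution_constant:
  fixes \<alpha> \<beta> :: "'p::prime_card mod_ring \<Rightarrow> int"
  assumes "\<And>x. (\<Sum>y\<in>UNIV. \<alpha> y * \<beta> (x - y)) = c"
  shows "(\<exists>c. \<forall>x. \<alpha> x = c) \<or> (\<exists>c. \<forall>x. \<beta> x = c)"
proof -
  have "geom_poly CARD('p) dvd mod_ring_poly \<alpha> * mod_ring_poly \<beta> - mod_ring_poly (\<lambda>_ :: 'p mod_ring. c)"
    using geom_poly_dvd_mod_ring_poly_mult[of \<alpha> \<beta>] by (simp only: assms)
  moreover have "geom_poly CARD('p) dvd mod_ring_poly (\<lambda>_ :: 'p mod_ring. c)"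
    by (simp add: mod_ring_poly_const dvd_smult)
  ultimately have "geom_poly CARD('p) dvd mod_ring_poly \<alpha> * mod_ring_poly \<beta>"
    by (simp add: dvd_diff_left_iff)
  then show ?thesis
    using prime_elem_dvd_multD[OF prime_elem_geom_poly[where 'p='p]]
    by (metis constant_if_geom_poly_dvd)
qed

subsection \<open>Tilings and projections\<close>

lemma one_tiling_unique:
  assumes "k_tiles 1 E A"
  shows "\<exists>!a. a \<in> A \<and> x - a \<in> E"
proof -
  have "card (A \<inter> {a. x - a \<in> E}) = 1"
  proof -
    have "(\<Sum>a\<in>A. indicator E (x - a) :: nat) = (\<Sum>a\<in>A. if x - a \<in> E then 1 else 0)"
      by (intro sum.cong) (auto simp: indicator_def)
    also have "\<dots> = card (A \<inter> {a. x - a \<in> E})"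
      by (simp add: sum.If_cases)
    finally show ?thesis
      using assms by (simp add: k_tiles_def)
  qed
  then obtain a where "A \<inter> {a. x - a \<in> E} = {a}"
    by (auto simp: card_1_singleton_iff)
  then show ?thesis by (intro ex1I[of _ a]) auto
qed

text \<open>A 1-tiling is a direct sum decomposition of the whole space: existence of the translate
  gives surjectivity, its uniqueness injectivity.\<close>

lemma one_tiling_bij_betw:
  assumes "k_tiles 1 E A"
  shows "bij_betw (\<lambda>(v, a). v + a) (E \<times> A) UNIV"
  unfolding bij_betw_def
proof
  show "inj_on (\<lambda>(v, a). v + a) (E \<times> A)"
  proof (rule inj_onI, clarsimp)
    fix v a w b assume "v \<in> E" "a \<in> A" "w \<in> E" "b \<in> A" and eq: "v + a = w + b"
    moreover from this have "v + a - b \<in> E" by simp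
    ultimately have "a = b"
      using one_tiling_unique[OF assms, of "v + a"] by (metis add_diff_cancel_right')
    with eq show "v = w \<and> a = b" by simp
  qed
  have "x \<in> (\<lambda>(v, a). v + a) ` (E \<times> A)" for x
  proof -
    obtain a where "a \<in> A" "x - a \<in> E"
      using one_tiling_unique[OF assms, of x] by auto
    then show ?thesis by (intro image_eqI[of _ _ "(x - a, a)"]) auto
  qed
  then show "(\<lambda>(v, a). v + a) ` (E \<times> A) = UNIV" by auto
qed

text \<open>By unique decomposition, convolving the fibre counts of \<open>E\<close> and
  \<open>A\<close> counts the points of a fibre of \<open>\<pi>\<close>. All these fibres have equal
  size, so the convolution is constant.\<close>

lemma one_tiling_fibres_equidistributed:
  fixes E A :: "('p::prime_card mod_ring ^ 'd::finite) set" and \<pi> :: "'p mod_ring ^ 'd \<Rightarrow> 'p mod_ring"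
  assumes tiles: "k_tiles 1 E A" and add: "\<And>u v. \<pi> (u + v) = \<pi> u + \<pi> v" and "surj \<pi>"
  shows "(\<exists>c. \<forall>x. card {v \<in> E. \<pi> v = x} = c) \<or> (\<exists>c. \<forall>x. card {a \<in> A. \<pi> a = x} = c)"
proof -
  let ?\<alpha> = "\<lambda>x. card {v \<in> E. \<pi> v = x}" and ?\<beta> = "\<lambda>x. card {a \<in> A. \<pi> a = x}"
  \<comment> \<open>Subtracting any preimage of \<open>x\<close> translates the fibre over
    \<open>x\<close> onto the fibre over 0.\<close>
  have fibre: "card {w. \<pi> w = x} = card {w. \<pi> w = 0}" for x
  proof -
    obtain u where u: "\<pi> u = x" using \<open>surj \<pi>\<close> by (metis surjD)
    have "\<pi> (w - u) = \<pi> w - x" for w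
      using add[of "w - u" u] by (simp add: u)
    then have "bij_betw (\<lambda>w. w - u) {w. \<pi> w = x} {w. \<pi> w = 0}"
      by (intro bij_betw_byWitness[where f'="\<lambda>w. w + u"]) (auto simp: add u)
    then show ?thesis by (rule bij_betw_same_card)
  qed
  have "(\<Sum>y\<in>UNIV. ?\<alpha> y * ?\<beta> (x - y)) = card {w. \<pi> w = 0}" for x
  proof -
    have "(\<Sum>y\<in>UNIV. ?\<alpha> y * ?\<beta> (x - y)) =
        card (\<Union>y\<in>UNIV. {v \<in> E. \<pi> v = y} \<times> {a \<in> A. \<pi> a = x - y})"
      by (subst card_UN_disjoint) (auto simp: card_cartesian_product)
    also have "\<dots> = card {w. \<pi> w = x}"
    proof (rule bij_betw_same_card)
      show "bij_betw (\<lambda>(v, a). v + a)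
          (\<Union>y\<in>UNIV. {v \<in> E. \<pi> v = y} \<times> {a \<in> A. \<pi> a = x - y}) {w. \<pi> w = x}"
        unfolding bij_betw_def
      proof
        show "inj_on (\<lambda>(v, a). v + a) (\<Union>y\<in>UNIV. {v \<in> E. \<pi> v = y} \<times> {a \<in> A. \<pi> a = x - y})"
          by (rule inj_on_subset[OF bij_betw_imp_inj_on[OF one_tiling_bij_betw[OF tiles]]]) auto
        show "(\<lambda>(v, a). v + a) ` (\<Union>y\<in>UNIV. {v \<in> E. \<pi> v = y} \<times> {a \<in> A. \<pi> a = x - y}) = {w. \<pi> w = x}"
        proof (intro equalityI subsetI)
          fix w assume w: "w \<in> {w. \<pi> w = x}"
          obtain v a where va: "v \<in> E" "a \<in> A" "w = v + a"
            using bij_betw_imp_surj_on[OF one_tiling_bij_betw[OF tiles]] by (force simp: image_def)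
          with w have "\<pi> a = x - \<pi> v" by (auto simp: add)
          with va show "w \<in> (\<lambda>(v, a). v + a) `
              (\<Union>y\<in>UNIV. {v \<in> E. \<pi> v = y} \<times> {a \<in> A. \<pi> a = x - y})"
            by (intro image_eqI[of _ _ "(v, a)"]) auto
        qed (auto simp: add)
      qed
    qed
    finally show ?thesis by (simp only: fibre[of x])
  qed
  then have "(\<Sum>y\<in>UNIV. int (?\<alpha> y) * int (?\<beta> (x - y))) = int (card {w. \<pi> w = 0})" for x
    by (simp flip: of_nat_mult of_nat_sum)
  note const = constant_if_convolution_constant[OF this]
  have const_nat: "\<exists>c. \<forall>x. h x = c" if "\<exists>c. \<forall>x. int (h x) = c" for h :: "'p mod_ring \<Rightarrow> nat"
    using that by (metis nat_int)
  from const show ?thesis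
    by (rule disj_forward) (erule const_nat)+
qed

lemma card_eq_sum_card_fibres:
  fixes \<pi> :: "'a::finite \<Rightarrow> 'b::finite"
  assumes "\<And>x. card {v \<in> S. \<pi> v = x} = c"
  shows "card S = CARD('b) * c"
proof -
  have "S = (\<Union>x\<in>UNIV. {v \<in> S. \<pi> v = x})" by auto
  then have "card S = card (\<Union>x\<in>UNIV. {v \<in> S. \<pi> v = x})" by simp
  also have "\<dots> = (\<Sum>x\<in>UNIV. card {v \<in> S. \<pi> v = x})"
    by (rule card_UN_disjoint) auto
  finally show ?thesis by (simp add: assms)
qed

section \<open>Coordinates and transversals in the plane\<close>

lemma vec2_eqI: "v $ 1 = w $ 1 \<Longrightarrow> v $ 2 = w $ 2 \<Longrightarrow> v = (w :: 'a ^ 2)"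
  by (simp add: vec_eq_iff forall_2)

text \<open>Cramer's rule: the coefficients are the determinants of \<open>(d, v)\<close> and
  \<open>(v, e)\<close>, and the denominator is the determinant of \<open>(d, e)\<close>, normalised
  to 1.\<close>

lemma cramer_expansion_2:
  fixes e d v :: "'a::comm_ring_1 ^ 2"
  assumes "d $ 1 * e $ 2 - d $ 2 * e $ 1 = 1"
  shows "v = (d $ 1 * v $ 2 - d $ 2 * v $ 1) *s e + (v $ 1 * e $ 2 - v $ 2 * e $ 1) *s d"
proof (rule vec2_eqI)
  show "v $ 1 = ((d $ 1 * v $ 2 - d $ 2 * v $ 1) *s e + (v $ 1 * e $ 2 - v $ 2 * e $ 1) *s d) $ 1"
  proof -
    have "v $ 1 = v $ 1 * (d $ 1 * e $ 2 - d $ 2 * e $ 1)" by (simp add: assms)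
    then show ?thesis by (simp add: algebra_simps)
  qed
  show "v $ 2 = ((d $ 1 * v $ 2 - d $ 2 * v $ 1) *s e + (v $ 1 * e $ 2 - v $ 2 * e $ 1) *s d) $ 2"
  proof -
    have "v $ 2 = v $ 2 * (d $ 1 * e $ 2 - d $ 2 * e $ 1)" by (simp add: assms)
    then show ?thesis by (simp add: algebra_simps)
  qed
qed

text \<open>Spanning comes from Cramer's rule; two distinct vectors spanning a space of dimension
  two are independent.\<close>

lemma is_basis_if_det_1:
  fixes e d :: "'p::prime_card mod_ring ^ 2"
  assumes "d $ 1 * e $ 2 - d $ 2 * e $ 1 = 1"
  shows "e \<noteq> d" "is_basis {e, d}"
proof -
  show "e \<noteq> d" using assms by auto
  have "v \<in> vec.span {e, d}" for v
    by (subst cramer_expansion_2[OF assms, of v])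
      (intro vec.span_add vec.span_scale vec.span_base; simp)
  then have span: "vec.span {e, d} = UNIV" by auto
  have "vec.independent {e, d}"
    by (rule vec.card_le_dim_spanning[of _ UNIV]) (use \<open>e \<noteq> d\<close> span in \<open>auto simp: vec_dim_card simp del: vec.dim_UNIV\<close>)
  with span show "is_basis {e, d}" by (simp add: is_basis_def)
qed

lemma ex_det_1:
  fixes d :: "'a::field ^ 2"
  assumes "d \<noteq> 0"
  shows "\<exists>e :: 'a ^ 2. d $ 1 * e $ 2 - d $ 2 * e $ 1 = 1"
proof (cases "d $ 1 = 0")
  case True
  with assms have "d $ 2 \<noteq> 0" by (metis vec2_eqI zero_index)
  with True show ?thesis by (intro exI[of _ "vector [- inverse (d $ 2), 0]"]) simp
next
  case False
  then show ?thesis by (intro exI[of _ "vector [0, inverse (d $ 1)]"]) simp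
qed

lemma one_tiling_line_transversal:
  fixes E A :: "('p::prime_card mod_ring ^ 2) set"
  assumes tiles: "k_tiles 1 E A" and "card E = CARD('p)" "card A = CARD('p)"
  shows "\<exists>e1 e2 (f :: 'p mod_ring \<Rightarrow> 'p mod_ring).
    e1 \<noteq> e2 \<and> is_basis {e1, e2} \<and> E = {x *s e1 + f x *s e2 | x. x \<in> UNIV}"
proof -
  have p: "CARD('p) > 1" using prime_gt_1_nat[OF prime_card] .
  then obtain a b where ab: "a \<in> A" "b \<in> A" "a \<noteq> b"
    using assms(3) card_le_Suc0_iff_eq[of A] by (metis One_nat_def finite leD)
  define d where "d = b - a"
  have "d \<noteq> 0" using ab by (simp add: d_def)
  then obtain e :: "'p mod_ring ^ 2" where e: "d $ 1 * e $ 2 - d $ 2 * e $ 1 = 1"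
    using ex_det_1 by blast
  \<comment> \<open>\<open>\<pi>\<close> is the determinant with \<open>d\<close> as first column.
    It vanishes at \<open>d\<close>, and its fibres are the lines parallel to \<open>d\<close>;
    \<open>\<sigma>\<close> is the coordinate along \<open>d\<close>.\<close>
  define \<pi> where "\<pi> v = d $ 1 * v $ 2 - d $ 2 * v $ 1" for v :: "'p mod_ring ^ 2"
  define \<sigma> where "\<sigma> v = v $ 1 * e $ 2 - v $ 2 * e $ 1" for v :: "'p mod_ring ^ 2"
  have expand: "v = \<pi> v *s e + \<sigma> v *s d" for v
    unfolding \<pi>_def \<sigma>_def by (rule cramer_expansion_2[OF e])
  have "\<pi> (x *s e) = x" for x
  proof -
    have "\<pi> (x *s e) = x * (d $ 1 * e $ 2 - d $ 2 * e $ 1)"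
      by (simp add: \<pi>_def algebra_simps)
    then show ?thesis by (simp add: e)
  qed
  then have "surj \<pi>" by (rule surjI)
  moreover have "\<pi> (u + v) = \<pi> u + \<pi> v" for u v
    by (simp add: \<pi>_def algebra_simps)
  ultimately have "(\<exists>c. \<forall>x. card {v \<in> E. \<pi> v = x} = c) \<or> (\<exists>c. \<forall>x. card {v \<in> A. \<pi> v = x} = c)"
    using one_tiling_fibres_equidistributed[OF tiles] by blast
  \<comment> \<open>With \<open>p\<close> fibres of constant size \<open>c\<close>, the equation
    \<open>p * c = p\<close> forces \<open>c = 1\<close>.\<close>
  moreover have one: "\<forall>x. card {v \<in> S. \<pi> v = x} = 1"
    if "card S = CARD('p)" "\<exists>c. \<forall>x. card {v \<in> S. \<pi> v = x} = c" for S
    using that p card_eq_sum_card_fibres[of S \<pi>] by auto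
  moreover have "\<not> (\<forall>x. card {v \<in> A. \<pi> v = x} = 1)"
  proof
    assume "\<forall>x. card {v \<in> A. \<pi> v = x} = 1"
    then obtain c where c: "{v \<in> A. \<pi> v = \<pi> a} = {c}"
      by (metis card_1_singletonE)
    \<comment> \<open>The difference \<open>b - a\<close> is \<open>d\<close>, on which
      \<open>\<pi>\<close> vanishes, so \<open>a\<close> and \<open>b\<close> lie on one parallel
      line.\<close>
    have "\<pi> b = \<pi> a" by (simp add: \<pi>_def d_def algebra_simps)
    with ab have "a \<in> {v \<in> A. \<pi> v = \<pi> a}" "b \<in> {v \<in> A. \<pi> v = \<pi> a}" by auto
    with c ab(3) show False by auto
  qed
  ultimately have E1: "\<forall>x. card {v \<in> E. \<pi> v = x} = 1"
    using assms(2,3) by blast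
  then have "\<forall>x. \<exists>v. {v \<in> E. \<pi> v = x} = {v}"
    by (metis card_1_singletonE)
  \<comment> \<open>\<open>g x\<close> is the only point of \<open>E\<close> on the line over
    \<open>x\<close>; its \<open>d\<close>-coordinate \<open>\<sigma> (g x)\<close> is the required
    function value.\<close>
  then obtain g where g: "\<And>x. {v \<in> E. \<pi> v = x} = {g x}" by metis
  then have g': "g x \<in> E" "\<pi> (g x) = x" for x
    by blast+
  have g_inv: "g (\<pi> v) = v" if "v \<in> E" for v
  proof -
    have "v \<in> {w \<in> E. \<pi> w = \<pi> v}" using that by simp
    then show ?thesis unfolding g by simp
  qed
  have "E = {x *s e + \<sigma> (g x) *s d | x. x \<in> UNIV}"
  proof (intro equalityI subsetI)
    fix v assume "v \<in> E"
    then have "v = \<pi> v *s e + \<sigma> (g (\<pi> v)) *s d"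
      by (simp only: g_inv) (rule expand)
    then show "v \<in> {x *s e + \<sigma> (g x) *s d | x. x \<in> UNIV}"
      by blast
  next
    fix v assume "v \<in> {x *s e + \<sigma> (g x) *s d | x. x \<in> UNIV}"
    then obtain x where "v = x *s e + \<sigma> (g x) *s d" by auto
    also have "\<dots> = g x" using expand[of "g x"] unfolding g'(2) by (rule sym)
    finally show "v \<in> E" using g'(1) by simp
  qed
  then show ?thesis
    using is_basis_if_det_1[OF e] by (intro exI[of _ e] exI[of _ d] exI[of _ "\<lambda>x. \<sigma> (g x)"]) simp
qed

subsection \<open>Graphs in the plane\<close>

lemma atLeast1_atMost_2: "{Suc 0..2} = {1, 2}"
  by auto

text \<open>The indexed basis in \<open>is_graph\<close> is fixed as \<open>e1\<close>,
  \<open>e2\<close> in this order, while \<open>s\<close> stays free so that points, function graphs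
  and the whole plane are all covered.\<close>

lemma is_graphI_2:
  fixes E :: "('p::prime_card mod_ring ^ 2) set"
  assumes "e1 \<noteq> e2" "is_basis {e1, e2}" "s \<le> 2" "f \<in> coord_space s \<rightarrow> coord_space (2 - s)"
    and "E = {(\<Sum>i=1..s. x i *s (if i = 1 then e1 else e2)) +
              (\<Sum>j=1..2 - s. f x j *s (if s + j = 1 then e1 else e2)) | x. x \<in> coord_space s}"
  shows "is_graph E"
proof -
  let ?e = "\<lambda>i::nat. if i = 1 then e1 else e2"
  have "inj_on ?e {1..2}" "?e ` {1..2} = {e1, e2}"
    using assms(1) by (auto simp: atLeast1_atMost_2)
  then show ?thesis
    unfolding is_graph_def using assms(2-)
    by (intro exI[of _ s] conjI exI[of _ ?e] bexI[of _ f]) simp_all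
qed

lemma is_graph_if_function_graph:
  fixes E :: "('p::prime_card mod_ring ^ 2) set"
  assumes "e1 \<noteq> e2" "is_basis {e1, e2}" "E = {x *s e1 + f x *s e2 | x. x \<in> UNIV}"
  shows "is_graph E"
proof (rule is_graphI_2[OF assms(1,2), where s = 1 and f = "\<lambda>x. \<lambda>j\<in>{1..1}. f (x 1)"])
  \<comment> \<open>Passes between tuples of length one and scalars, since \<open>is_graph\<close>
    quantifies over the former.\<close>
  have "(\<exists>x. P (x 1) \<and> x \<in> coord_space 1) \<longleftrightarrow> (\<exists>x. P x)" for P :: "'p mod_ring \<Rightarrow> bool"
  proof
    assume "\<exists>x. P x"
    then obtain x where "P x" ..
    then show "\<exists>x. P (x 1) \<and> x \<in> coord_space 1"
      by (intro exI[of _ "\<lambda>j\<in>{1..1}. x"]) (auto simp: coord_space_def)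
  qed auto
  from this[of "\<lambda>x. v = x *s e1 + f x *s e2" for v]
  show "E = {(\<Sum>i=1..1. x i *s (if i = 1 then e1 else e2)) +
      (\<Sum>j=1..(2 - 1 :: nat). (\<lambda>j\<in>{1..1}. f (x 1)) j *s (if 1 + j = 1 then e1 else e2)) | x. x \<in> coord_space 1}"
    by (auto simp: assms(3))
qed (simp_all add: coord_space_def)

lemma ex_basis_coordinates_2:
  "\<exists>e1 e2 :: 'p::prime_card mod_ring ^ 2. e1 \<noteq> e2 \<and> is_basis {e1, e2} \<and>
    (\<forall>v. \<exists>x y. v = x *s e1 + y *s e2)"
proof -
  let ?e = "vector [0, 1] :: 'p mod_ring ^ 2" and ?d = "vector [1, 0] :: 'p mod_ring ^ 2"
  have "?d $ 1 * ?e $ 2 - ?d $ 2 * ?e $ 1 = 1" by simp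
  from is_basis_if_det_1[OF this] cramer_expansion_2[OF this] show ?thesis by blast
qed

lemma is_graph_singleton: "is_graph {v :: 'p::prime_card mod_ring ^ 2}"
proof -
  obtain e1 e2 :: "'p mod_ring ^ 2" where e: "e1 \<noteq> e2" "is_basis {e1, e2}"
    and "\<exists>x y. v = x *s e1 + y *s e2"
    using ex_basis_coordinates_2 by metis
  then obtain x y where v: "v = x *s e1 + y *s e2" by blast
  show ?thesis
    \<comment> \<open>A point is the graph of a function on the one-point space
      \<open>coord_space 0\<close>, whose value holds the coordinates of \<open>v\<close>.\<close>
    by (rule is_graphI_2[OF e, where s = 0 and f = "\<lambda>_. \<lambda>j\<in>{1..2}. if j = 1 then x else y"])
      (auto simp: coord_space_def v atLeast1_atMost_2)
qed

lemma is_graph_UNIV: "is_graph (UNIV :: ('p::prime_card mod_ring ^ 2) set)"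
proof -
  obtain e1 e2 :: "'p mod_ring ^ 2" where e: "e1 \<noteq> e2" "is_basis {e1, e2}"
    and all: "\<And>v. \<exists>x y. v = x *s e1 + y *s e2"
    using ex_basis_coordinates_2 by metis
  show ?thesis
  \<comment> \<open>The target \<open>coord_space 0\<close> contains only the function that is
    \<open>undefined\<close> everywhere.\<close>
  proof (rule is_graphI_2[OF e, where s = 2 and f = "\<lambda>_ _. undefined"])
    have "\<exists>z. v = z 1 *s e1 + z 2 *s e2 \<and> z \<in> coord_space 2" for v
    proof -
      obtain x y where "v = x *s e1 + y *s e2" using all by blast
      then show ?thesis
        by (intro exI[of _ "\<lambda>j\<in>{1..2}. if j = 1 then x else y"]) (auto simp: coord_space_def)
    qed
    then show "UNIV = {(\<Sum>i=1..2. x i *s (if i = 1 then e1 else e2)) +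
        (\<Sum>j=1..(2 - 2 :: nat). undefined *s (if 2 + j = 1 then e1 else e2)) | x. x \<in> coord_space 2}"
      by (auto simp: atLeast1_atMost_2)
  qed (simp_all add: coord_space_def)
qed

section \<open>Fermat's little theorem and interpolation over the prime field\<close>

lemma power_card_minus_1_mod_ring:
  "x \<noteq> 0 \<Longrightarrow> (x :: 'p::prime_card mod_ring) ^ (CARD('p) - 1) = 1"
proof -
  assume x: "x \<noteq> 0"
  have p: "CARD('p) > 1" using prime_gt_1_nat[OF prime_card] .
  have "x ^ (CARD('p) - 1) = x ^ (CARD('p) - 2) * x"
    using p by (metis Suc_1 Suc_diff_Suc power_Suc2)
  \<comment> \<open>The inverse of a nonzero element is defined as this power, so Fermat's theorem
    follows from the field axioms.\<close>
  also have "x ^ (CARD('p) - 2) = inverse x"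
    using x by (simp add: inverse_mod_ring_def)
  finally show ?thesis using x by simp
qed

text \<open>By Fermat's theorem \<open>1 - (x - c)^(p-1)\<close> is 1 at \<open>x = c\<close> and 0
  elsewhere; \<open>f\<close> is the combination of these indicators with weights
  \<open>f c\<close>.\<close>

lemma mod_ring_function_is_poly:
  fixes f :: "'p::prime_card mod_ring \<Rightarrow> 'p mod_ring"
  shows "\<exists>q. degree q \<le> CARD('p) - 1 \<and> (\<forall>x. f x = poly q x)"
proof -
  have p: "CARD('p) > 1" using prime_gt_1_nat[OF prime_card] .
  let ?q = "\<Sum>c\<in>UNIV. [:f c:] * (1 - [:-c, 1:] ^ (CARD('p) - 1))"
  have "degree ?q \<le> CARD('p) - 1"
  proof (rule degree_sum_le)
    fix c :: "'p mod_ring"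
    have "degree ([:-c, 1:] ^ (CARD('p) - 1)) \<le> CARD('p) - 1"
      using degree_power_le[of "[:-c, 1:]" "CARD('p) - 1"] by simp
    then have "degree (1 - [:-c, 1:] ^ (CARD('p) - 1)) \<le> CARD('p) - 1"
      by (intro degree_diff_le) auto
    then show "degree ([:f c:] * (1 - [:-c, 1:] ^ (CARD('p) - 1))) \<le> CARD('p) - 1"
      by (intro order.trans[OF degree_mult_le]) simp
  qed simp
  moreover have "f x = poly ?q x" for x
  proof -
    have "poly ?q x = (\<Sum>c\<in>UNIV. f c * (1 - (x - c) ^ (CARD('p) - 1)))"
      by (simp add: poly_sum)
    also have "\<dots> = (\<Sum>c\<in>UNIV. if c = x then f c else 0)"
    proof (rule sum.cong[OF refl])
      fix c
      show "f c * (1 - (x - c) ^ (CARD('p) - 1)) = (if c = x then f c else 0)"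
        using p power_card_minus_1_mod_ring[of "x - c"] by (cases "c = x") auto
    qed
    also have "\<dots> = f x" by simp
    finally show ?thesis by simp
  qed
  ultimately show ?thesis by blast
qed

text \<open>The polynomial claim is stated for every function representing \<open>E\<close>, not
  just for one suitable choice.\<close>

theorem mainTheorem2:
  fixes E A :: "('p::prime_card mod_ring ^ 2) set"
  assumes "k_tiles 1 E A"
  shows "is_graph E
    \<and> (card E = 1 \<and> A = UNIV
       \<or> E = UNIV \<and> card A = 1
       \<or> (\<exists>e1 e2 (f :: 'p mod_ring \<Rightarrow> 'p mod_ring).
             e1 \<noteq> e2 \<and> is_basis {e1, e2} \<and> E = {x *s e1 + f x *s e2 | x. x \<in> UNIV}))
    \<and> (\<forall>e1 e2 (f :: 'p mod_ring \<Rightarrow> 'p mod_ring).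
          e1 \<noteq> e2 \<and> is_basis {e1, e2} \<and> E = {x *s e1 + f x *s e2 | x. x \<in> UNIV}
          \<longrightarrow> (\<exists>q :: 'p mod_ring poly. degree q \<le> CARD('p) - 1 \<and> (\<forall>x. f x = poly q x)))"
proof -
  have p: "prime CARD('p)" by (rule prime_card)
  have card_UNIV: "CARD('p mod_ring ^ 2) = CARD('p) ^ 2"
    by simp
  have prod: "card E * card A = CARD('p) ^ 2"
    using bij_betw_same_card[OF one_tiling_bij_betw[OF assms]] card_UNIV
    by (simp add: card_cartesian_product)
  then have "card E dvd CARD('p) ^ 2" by (metis dvd_triv_left)
  then obtain i where i: "i \<le> 2" "card E = CARD('p) ^ i"
    using divides_primepow_nat[OF p] by blast
  have p0: "CARD('p) > 0" using prime_gt_0_nat[OF p] .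
  \<comment> \<open>The divisors of \<open>p^2\<close> give the three alternatives: a single point,
    a transversal to a family of parallel lines, the whole plane.\<close>
  consider "i = 0" | "i = 1" | "i = 2" using i(1) by linarith
  then have "is_graph E \<and> (card E = 1 \<and> A = UNIV \<or> E = UNIV \<and> card A = 1
       \<or> (\<exists>e1 e2 (f :: 'p mod_ring \<Rightarrow> 'p mod_ring).
             e1 \<noteq> e2 \<and> is_basis {e1, e2} \<and> E = {x *s e1 + f x *s e2 | x. x \<in> UNIV}))"
  proof cases
    case 1
    then have E: "card E = 1" using i by simp
    moreover have "card A = CARD('p mod_ring ^ 2)" using prod E by simp
    then have "A = UNIV" by (intro card_subset_eq) auto
    moreover have "is_graph E" using E is_graph_singleton by (metis card_1_singletonE)
    ultimately show ?thesis by blast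
  next
    case 2
    then have "card E = CARD('p)" using i by simp
    moreover from this have "card A = CARD('p)" using prod p0 by (simp add: power2_eq_square)
    ultimately show ?thesis
      using one_tiling_line_transversal[OF assms] is_graph_if_function_graph by blast
  next
    case 3
    then have "card E = CARD('p mod_ring ^ 2)" using i by simp
    then have "E = UNIV" by (intro card_subset_eq) auto
    moreover have "card A = 1" using prod 3 i p0 by simp
    ultimately show ?thesis using is_graph_UNIV by blast
  qed
  then show ?thesis using mod_ring_function_is_poly by blast
qed

end
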